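(* Let $F:\mathbb{R}\times\mathbb{R}^m\to\mathbb{R}^m$ be contractive with respect to some semi-norm $\|\cdot\|$ on $\mathbb{R}^m$ in the sense that, for some $\tau_0>0$, $$\|U+\tau F(t,U)-(\widetilde U+\tau F(t,\widetilde U))\|\le\|U-\widetilde U\|\quad\text{for all } t\in\mathbb{R},\ U,\widetilde U\in\mathbb{R}^m \text{ and all } 0\le\tau\le\tau_0 .$$ Let an explicit $s$-stage Runge--Kutta method with SSP coefficient $\mathcal{C}>0$ be given in canonical Shu--Osher form $\alpha,\beta$ and applied with step size $\tau\le\mathcal{C}\tau_0$. Let $U_{n+1}$ be the result of the unperturbed method started from $U_n$, let $\widetilde U_{n+1}$ be the result of the perturbed method started from $\widetilde U_n$ with stage residuals $\tilde r_1,\dots,\tilde r_{s+1}\in\mathbb{R}^m$, and let $\epsilon_n=\widetilde U_n-U_n$, $\epsilon_{n+1}=\widetilde U_{n+1}-U_{n+1}$. Then $$\|\epsilon_{n+1}\|\le\|\epsilon_n\|+\sum_{j=1}^{s+1}\|\tilde r_j\|.$$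
   Context: An explicit Runge--Kutta method in Shu--Osher form is given by strictly lower triangular real $(s+1)\times(s+1)$ matrices $\alpha,\beta$, with $v_i=1-\sum_j\alpha_{ij}$: $$Y_i=v_iU_n+\sum_{j=1}^{i-1}\big(\alpha_{ij}Y_j+\tau\beta_{ij}F(t_n+c_j\tau,Y_j)\big)\ (1\le i\le s+1),\qquad U_{n+1}=Y_{s+1}.$$ Here $c=(I_s-\alpha_{1:s})^{-1}\beta_{1:s}\mathbf{1}$, with $\alpha_{1:s},\beta_{1:s}$ the upper-left $s\times s$ blocks. The perturbed method is $$\widetilde Y_i=v_i\widetilde U_n+\sum_{j=1}^{i-1}\big(\alpha_{ij}\widetilde Y_j+\tau\beta_{ij}F(t_n+c_j\tau,\widetilde Y_j)\big)+\tilde r_i\ (1\le i\le s+1),\qquad \widetilde U_{n+1}=\widetilde Y_{s+1}.$$ A strong stability preserving (SSP) Runge--Kutta method with SSP coefficient $\mathcal{C}$ can be written in canonical Shu--Osher form, meaning that $\alpha=\mathcal{C}\beta$, $\alpha_{ij}\ge0$ for all $i,j$, and all row sums of $\alpha$ are at most $1$. *)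

theory Defs
  imports "HOL-Analysis.Analysis" "Jordan_Normal_Form.Determinant"
begin

definition semi_norm :: "(real ^ 'm \<Rightarrow> real) \<Rightarrow> bool" where
  "semi_norm N \<longleftrightarrow>
     (\<forall>x y. N (x + y) \<le> N x + N y) \<and> (\<forall>a x. N (a *\<^sub>R x) = \<bar>a\<bar> * N x)"

definition contractive :: "(real ^ 'm \<Rightarrow> real) \<Rightarrow> real \<Rightarrow> (real \<Rightarrow> real ^ 'm \<Rightarrow> real ^ 'm) \<Rightarrow> bool" where
  "contractive N \<tau>0 F \<longleftrightarrow>
     (\<forall>t U U' \<tau>. 0 \<le> \<tau> \<longrightarrow> \<tau> \<le> \<tau>0 \<longrightarrow>
        N ((U + \<tau> *\<^sub>R F t U) - (U' + \<tau> *\<^sub>R F t U')) \<le> N (U - U'))"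

text \<open>
  Stages are numbered from 0, following the indexing of matrices: the stages
  of an \<open>s\<close>-stage method are \<open>Y 0, \<dots>, Y s\<close>, and \<open>Y s\<close> is the new approximation.
\<close>

definition strictly_lower_triangular :: "real mat \<Rightarrow> bool" where
  "strictly_lower_triangular A \<longleftrightarrow>
     (\<forall>i < dim_row A. \<forall>j < dim_col A. i \<le> j \<longrightarrow> A $$ (i, j) = 0)"

definition explicit_shu_osher :: "nat \<Rightarrow> real mat \<Rightarrow> real mat \<Rightarrow> bool" where
  "explicit_shu_osher s \<alpha> \<beta> \<longleftrightarrow>
     \<alpha> \<in> carrier_mat (s + 1) (s + 1) \<and> \<beta> \<in> carrier_mat (s + 1) (s + 1) \<and>
     strictly_lower_triangular \<alpha> \<and> strictly_lower_triangular \<beta>"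

definition so_weight :: "nat \<Rightarrow> real mat \<Rightarrow> nat \<Rightarrow> real" where
  "so_weight s \<alpha> i = 1 - (\<Sum>j<s + 1. \<alpha> $$ (i, j))"

definition leading_block :: "nat \<Rightarrow> real mat \<Rightarrow> real mat" where
  "leading_block s A = Matrix.mat s s (\<lambda>(i, j). A $$ (i, j))"

definition so_abscissae :: "nat \<Rightarrow> real mat \<Rightarrow> real mat \<Rightarrow> real Matrix.vec" where
  "so_abscissae s \<alpha> \<beta> =
     the (mat_inverse (1\<^sub>m s - leading_block s \<alpha>)) *\<^sub>v (leading_block s \<beta> *\<^sub>v Matrix.vec s (\<lambda>_. 1))"

lemma mat_inverse_abscissae:
  assumes "explicit_shu_osher s \<alpha> \<beta>"
  shows "\<exists>B. mat_inverse (1\<^sub>m s - leading_block s \<alpha>) = Some B \<and> B \<in> carrier_mat s s \<and>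
           B * (1\<^sub>m s - leading_block s \<alpha>) = 1\<^sub>m s \<and> (1\<^sub>m s - leading_block s \<alpha>) * B = 1\<^sub>m s"
proof -
  let ?M = "1\<^sub>m s - leading_block s \<alpha>"
  have M: "?M \<in> carrier_mat s s" by (intro minus_carrier_mat) (simp add: leading_block_def)
  have "Determinant.det ?M = prod_list (diag_mat ?M)"
    using assms by (intro det_lower_triangular[OF _ M])
      (auto simp: leading_block_def explicit_shu_osher_def strictly_lower_triangular_def)
  also have "diag_mat ?M = map (\<lambda>_. 1) [0..<s]"
    using assms by (auto simp: diag_mat_def leading_block_def explicit_shu_osher_def
        strictly_lower_triangular_def)
  also have "prod_list (map (\<lambda>_. 1 :: real) [0..<s]) = 1"
    by (induction s) auto
  finally have "Determinant.det ?M \<noteq> 0" by simp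
  then have "?M \<in> Units (ring_mat TYPE(real) s ())"
    by (rule det_non_zero_imp_unit[OF M])
  then have "mat_inverse ?M \<noteq> None"
    using mat_inverse(1)[OF M, of "()"] by blast
  then show ?thesis
    using mat_inverse(2)[OF M] by blast
qed

text \<open>
  An SSP coefficient \<open>C\<close> enters only as the constant of the canonical form; it is not required
  to be the largest constant for which the method has such a form.
\<close>

definition canonical_shu_osher :: "nat \<Rightarrow> real \<Rightarrow> real mat \<Rightarrow> real mat \<Rightarrow> bool" where
  "canonical_shu_osher s C \<alpha> \<beta> \<longleftrightarrow>
     explicit_shu_osher s \<alpha> \<beta> \<and>
     \<alpha> = C \<cdot>\<^sub>m \<beta> \<and>
     (\<forall>i < s + 1. \<forall>j < s + 1. \<alpha> $$ (i, j) \<ge> 0) \<and>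
     (\<forall>i < s + 1. (\<Sum>j<s + 1. \<alpha> $$ (i, j)) \<le> 1)"

definition shu_osher_step ::
  "nat \<Rightarrow> real mat \<Rightarrow> real mat \<Rightarrow> (real \<Rightarrow> real ^ 'm \<Rightarrow> real ^ 'm) \<Rightarrow> real \<Rightarrow> real
    \<Rightarrow> real ^ 'm \<Rightarrow> real ^ 'm \<Rightarrow> bool" where
  "shu_osher_step s \<alpha> \<beta> F \<tau> t U U' \<longleftrightarrow>
     (\<exists>Y :: nat \<Rightarrow> real ^ 'm.
        (\<forall>i < s + 1.
           Y i = so_weight s \<alpha> i *\<^sub>R U
             + (\<Sum>j<i. \<alpha> $$ (i, j) *\<^sub>R Y j
                 + (\<tau> * \<beta> $$ (i, j)) *\<^sub>R F (t + vec_index (so_abscissae s \<alpha> \<beta>) j * \<tau>) (Y j))) \<and>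
        U' = Y s)"

definition perturbed_shu_osher_step ::
  "nat \<Rightarrow> real mat \<Rightarrow> real mat \<Rightarrow> (real \<Rightarrow> real ^ 'm \<Rightarrow> real ^ 'm) \<Rightarrow> real \<Rightarrow> real
    \<Rightarrow> (nat \<Rightarrow> real ^ 'm) \<Rightarrow> real ^ 'm \<Rightarrow> real ^ 'm \<Rightarrow> bool" where
  "perturbed_shu_osher_step s \<alpha> \<beta> F \<tau> t r U U' \<longleftrightarrow>
     (\<exists>Y :: nat \<Rightarrow> real ^ 'm.
        (\<forall>i < s + 1.
           Y i = so_weight s \<alpha> i *\<^sub>R U
             + (\<Sum>j<i. \<alpha> $$ (i, j) *\<^sub>R Y j
                 + (\<tau> * \<beta> $$ (i, j)) *\<^sub>R F (t + vec_index (so_abscissae s \<alpha> \<beta>) j * \<tau>) (Y j))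
             + r i) \<and>
        U' = Y s)"

end

theory Submission
  imports Defs
begin

text \<open>
  The canonical relation \<open>\<alpha> = C \<beta>\<close> pairs \<open>\<alpha>\<^sub>i\<^sub>j Y\<^sub>j\<close> with
  \<open>\<tau> \<beta>\<^sub>i\<^sub>j F\<close> into \<open>\<alpha>\<^sub>i\<^sub>j (Y\<^sub>j + (\<tau> / C) F)\<close>, a multiple of a
  forward Euler step of length \<open>\<tau> / C \<le> \<tau>0\<close>. As the entries of \<open>\<alpha>\<close> are nonnegative and its
  row sums are at most 1, each stage is thus a convex combination of the initial value and of
  Euler steps from earlier stages; this is \<open>canonical_stage_increment\<close> with
  \<open>so_weight_add_row_sum\<close>. Subtracting the two schemes, each stage error is, up to the residual
  of that stage, a convex combination of the initial error and of differences of Euler steps,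
  which contractivity bounds by the earlier stage errors. The largest of those bounds therefore
  grows by at most the norm of the new residual from one stage to the next
  (\<open>stage_error_le\<close>). In particular no constant depending on the method appears, although
  a residual may influence the result through many later stages.
\<close>

lemma semi_norm_add: "semi_norm N \<Longrightarrow> N (x + y) \<le> N x + N y"
  by (simp add: semi_norm_def)

lemma semi_norm_scaleR: "semi_norm N \<Longrightarrow> N (a *\<^sub>R x) = \<bar>a\<bar> * N x"
  by (simp add: semi_norm_def)

lemma semi_norm_zero: "semi_norm N \<Longrightarrow> N 0 = 0"
  using semi_norm_scaleR[of N 0 0] by simp

lemma semi_norm_nonneg:
  assumes "semi_norm N"
  shows "0 \<le> N x"
  using semi_norm_add[OF assms, of x "- x"] semi_norm_scaleR[OF assms, of "- 1" x]
    semi_norm_zero[OF assms] by simp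

lemma semi_norm_sum:
  assumes "semi_norm N"
  shows "N (\<Sum>j\<in>A. f j) \<le> (\<Sum>j\<in>A. N (f j))"
proof (induction A rule: infinite_finite_induct)
  case (insert x A)
  then show ?case
    using semi_norm_add[OF assms, of "f x" "sum f A"] by simp
qed (simp_all add: semi_norm_zero[OF assms])

text \<open>Balls of a semi-norm are convex.\<close>

lemma semi_norm_convex_combination_le:
  assumes N: "semi_norm N"
    and v: "0 \<le> v" and a: "\<And>j. j \<in> A \<Longrightarrow> 0 \<le> a j" and one: "v + (\<Sum>j\<in>A. a j) = 1"
    and d: "N d \<le> M" and x: "\<And>j. j \<in> A \<Longrightarrow> N (x j) \<le> M"
  shows "N (v *\<^sub>R d + (\<Sum>j\<in>A. a j *\<^sub>R x j)) \<le> M"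
proof -
  have "N (\<Sum>j\<in>A. a j *\<^sub>R x j) \<le> (\<Sum>j\<in>A. N (a j *\<^sub>R x j))"
    by (rule semi_norm_sum[OF N])
  also have "\<dots> \<le> (\<Sum>j\<in>A. a j * M)"
    by (intro sum_mono) (simp add: semi_norm_scaleR[OF N] a x mult_left_mono)
  finally have sum: "N (\<Sum>j\<in>A. a j *\<^sub>R x j) \<le> (\<Sum>j\<in>A. a j) * M"
    by (simp add: sum_distrib_right)
  have "N (v *\<^sub>R d) \<le> v * M"
    using v d by (simp add: semi_norm_scaleR[OF N] mult_left_mono)
  then have "N (v *\<^sub>R d + (\<Sum>j\<in>A. a j *\<^sub>R x j)) \<le> (v + (\<Sum>j\<in>A. a j)) * M"
    using semi_norm_add[OF N, of "v *\<^sub>R d" "\<Sum>j\<in>A. a j *\<^sub>R x j"] sum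
    by (simp add: distrib_right)
  then show ?thesis
    by (simp add: one)
qed

text \<open>
  The error recursion on its own, with \<open>e i\<close> the error of stage \<open>i\<close> and \<open>x j\<close> the
  difference of the Euler steps taken from stage \<open>j\<close>. The induction works because all
  summands of stage \<open>i\<close> lie in one common ball, whose radius counts each earlier residual
  exactly once; convexity keeps their combination in it.
\<close>

lemma stage_error_le:
  fixes v :: "nat \<Rightarrow> real" and a :: "nat \<Rightarrow> nat \<Rightarrow> real"
  assumes N: "semi_norm N"
    and v: "\<And>i. i < n \<Longrightarrow> 0 \<le> v i"
    and a: "\<And>i j. i < n \<Longrightarrow> j < i \<Longrightarrow> 0 \<le> a i j"
    and one: "\<And>i. i < n \<Longrightarrow> v i + (\<Sum>j<i. a i j) = 1"
    and e: "\<And>i. i < n \<Longrightarrow> e i = v i *\<^sub>R d + (\<Sum>j<i. a i j *\<^sub>R x j) + r i"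
    and x: "\<And>j. j < n \<Longrightarrow> N (x j) \<le> N (e j)"
    and i: "i < n"
  shows "N (e i) \<le> N d + (\<Sum>j\<le>i. N (r j))"
  using i
proof (induction i rule: less_induct)
  case (less i)
  let ?M = "N d + (\<Sum>j<i. N (r j))"
  have "N (x j) \<le> ?M" if "j < i" for j
  proof -
    have "N (x j) \<le> N d + (\<Sum>k\<le>j. N (r k))"
      using x[of j] less.IH[OF that] less.prems that by simp
    also have "\<dots> \<le> ?M"
      using that by (intro add_left_mono sum_mono2) (auto simp: semi_norm_nonneg[OF N])
    finally show ?thesis .
  qed
  moreover have "N d \<le> ?M"
    by (simp add: sum_nonneg semi_norm_nonneg[OF N])
  ultimately have "N (v i *\<^sub>R d + (\<Sum>j<i. a i j *\<^sub>R x j)) \<le> ?M"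
    using v a one less.prems by (intro semi_norm_convex_combination_le[OF N]) auto
  then have "N (e i) \<le> ?M + N (r i)"
    using semi_norm_add[OF N, of "v i *\<^sub>R d + (\<Sum>j<i. a i j *\<^sub>R x j)" "r i"] e[OF less.prems]
    by simp
  then show ?case
    by (simp add: lessThan_Suc_atMost[symmetric])
qed

text \<open>
  The weight is defined by a full row sum, whereas a stage sums over earlier stages only;
  the two agree because \<open>\<alpha>\<close> vanishes on and above the diagonal.
\<close>

lemma so_weight_add_row_sum:
  assumes "explicit_shu_osher s \<alpha> \<beta>" and "i < s + 1"
  shows "so_weight s \<alpha> i + (\<Sum>j<i. \<alpha> $$ (i, j)) = 1"
proof -
  have "(\<Sum>j<s + 1. \<alpha> $$ (i, j)) = (\<Sum>j<i. \<alpha> $$ (i, j))"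
    using assms
    by (intro sum.mono_neutral_right)
      (auto simp: explicit_shu_osher_def strictly_lower_triangular_def)
  then show ?thesis
    by (simp add: so_weight_def)
qed

text \<open>
  Since \<open>\<tau> \<beta>\<^sub>i\<^sub>j = \<alpha>\<^sub>i\<^sub>j (\<tau> / C)\<close>, the two contributions of an earlier
  stage merge into one multiple of a forward Euler step.
\<close>

lemma canonical_stage_increment:
  fixes y f :: "'a :: real_vector"
  assumes "canonical_shu_osher s C \<alpha> \<beta>" and "C > 0" and "i < s + 1" and "j < s + 1"
  shows "\<alpha> $$ (i, j) *\<^sub>R y + (\<tau> * \<beta> $$ (i, j)) *\<^sub>R f = \<alpha> $$ (i, j) *\<^sub>R (y + (\<tau> / C) *\<^sub>R f)"
proof -
  have "\<alpha> $$ (i, j) = C * \<beta> $$ (i, j)"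
    using assms by (auto simp: canonical_shu_osher_def explicit_shu_osher_def)
  then show ?thesis
    using \<open>C > 0\<close> by (simp add: scaleR_right_distrib mult.commute[of \<tau>])
qed

theorem theorem3p1:
  fixes F :: "real \<Rightarrow> real ^ 'm \<Rightarrow> real ^ 'm"
    and N :: "real ^ 'm \<Rightarrow> real"
    and \<alpha> \<beta> :: "real mat"
    and s :: nat
    and C \<tau>0 \<tau> tn :: real
    and r :: "nat \<Rightarrow> real ^ 'm"
    and U0 U1 V0 V1 \<epsilon>n \<epsilon>n1 :: "real ^ 'm"
  assumes "semi_norm N"
    and "\<tau>0 > 0"
    and "contractive N \<tau>0 F"
    and "C > 0"
    and "canonical_shu_osher s C \<alpha> \<beta>"
    and "0 \<le> \<tau>"
    and "\<tau> \<le> C * \<tau>0"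
    and "shu_osher_step s \<alpha> \<beta> F \<tau> tn U0 U1"
    and "perturbed_shu_osher_step s \<alpha> \<beta> F \<tau> tn r V0 V1"
    and "\<epsilon>n = V0 - U0"
    and "\<epsilon>n1 = V1 - U1"
  shows "N \<epsilon>n1 \<le> N \<epsilon>n + (\<Sum>j<s + 1. N (r j))"
proof -
  note N = assms(1) and canonical = assms(5)
  have explicit: "explicit_shu_osher s \<alpha> \<beta>"
    using canonical unfolding canonical_shu_osher_def by blast
  define c where "c j = tn + vec_index (so_abscissae s \<alpha> \<beta>) j * \<tau>" for j
  define E where "E j y = y + (\<tau> / C) *\<^sub>R F (c j) y" for j y
  have increments: "(\<Sum>j<i. \<alpha> $$ (i, j) *\<^sub>R Y j + (\<tau> * \<beta> $$ (i, j)) *\<^sub>R F (c j) (Y j))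
      = (\<Sum>j<i. \<alpha> $$ (i, j) *\<^sub>R E j (Y j))" if "i < s + 1" for i Y
    unfolding E_def using that
    by (intro sum.cong refl canonical_stage_increment[OF canonical \<open>C > 0\<close>]) auto
  obtain Y where Y_stage: "\<forall>i<s + 1. Y i = so_weight s \<alpha> i *\<^sub>R U0
      + (\<Sum>j<i. \<alpha> $$ (i, j) *\<^sub>R Y j + (\<tau> * \<beta> $$ (i, j)) *\<^sub>R F (c j) (Y j))"
    and U1: "U1 = Y s"
    using assms(8) unfolding shu_osher_step_def c_def[symmetric] by blast
  have Y: "Y i = so_weight s \<alpha> i *\<^sub>R U0 + (\<Sum>j<i. \<alpha> $$ (i, j) *\<^sub>R E j (Y j))"
    if "i < s + 1" for i
    using Y_stage[rule_format, OF that] unfolding increments[OF that] .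
  obtain Z where Z_stage: "\<forall>i<s + 1. Z i = so_weight s \<alpha> i *\<^sub>R V0
      + (\<Sum>j<i. \<alpha> $$ (i, j) *\<^sub>R Z j + (\<tau> * \<beta> $$ (i, j)) *\<^sub>R F (c j) (Z j)) + r i"
    and V1: "V1 = Z s"
    using assms(9) unfolding perturbed_shu_osher_step_def c_def[symmetric] by blast
  have Z: "Z i = so_weight s \<alpha> i *\<^sub>R V0 + (\<Sum>j<i. \<alpha> $$ (i, j) *\<^sub>R E j (Z j)) + r i"
    if "i < s + 1" for i
    using Z_stage[rule_format, OF that] unfolding increments[OF that] .
  have "0 \<le> \<tau> / C" "\<tau> / C \<le> \<tau>0"
    using \<open>C > 0\<close> \<open>0 \<le> \<tau>\<close> \<open>\<tau> \<le> C * \<tau>0\<close> by (simp_all add: field_simps)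
  then have Euler: "N (E j (Z j) - E j (Y j)) \<le> N (Z j - Y j)" for j
    using assms(3) by (simp add: contractive_def E_def)
  have "N (Z s - Y s) \<le> N (V0 - U0) + (\<Sum>j\<le>s. N (r j))"
  proof (rule stage_error_le[OF N, where n = "s + 1" and v = "so_weight s \<alpha>"
        and a = "\<lambda>i j. \<alpha> $$ (i, j)" and e = "\<lambda>i. Z i - Y i"
        and x = "\<lambda>j. E j (Z j) - E j (Y j)"])
    show "0 \<le> so_weight s \<alpha> i" if "i < s + 1" for i
      using canonical that unfolding canonical_shu_osher_def so_weight_def diff_ge_0_iff_ge by blast
    show "0 \<le> \<alpha> $$ (i, j)" if "i < s + 1" "j < i" for i j
      using canonical that unfolding canonical_shu_osher_def
      by (meson less_trans)
    show "so_weight s \<alpha> i + (\<Sum>j<i. \<alpha> $$ (i, j)) = 1" if "i < s + 1" for i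
      by (rule so_weight_add_row_sum[OF explicit that])
    show "Z i - Y i = so_weight s \<alpha> i *\<^sub>R (V0 - U0)
        + (\<Sum>j<i. \<alpha> $$ (i, j) *\<^sub>R (E j (Z j) - E j (Y j))) + r i" if "i < s + 1" for i
      using Y[OF that] Z[OF that] by (simp add: scaleR_right_diff_distrib sum_subtractf)
  qed (use Euler in auto)
  then show ?thesis
    by (simp add: assms(10,11) U1 V1 lessThan_Suc_atMost)
qed

end
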